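(* For every integer $m$ with $0<m<\omega$, every countable subgroup $G$ of the additive group $(\mathbb{R}^m,+)$ (with the Euclidean topology) is compactly generated.
   Context: A subgroup $G$ of a topological group is compactly generated if there is a compact set $C\subseteq G$ such that $G$ is the subgroup generated by $C$. *)

theory Defs
  imports "HOL-Analysis.Analysis" "HOL-Algebra.Generated_Groups"
begin

definition additive_group :: "'a::group_add monoid" where
  "additive_group = \<lparr>carrier = UNIV, monoid.mult = (+), one = 0\<rparr>"

lemma group_additive_group: "group (additive_group :: 'a::group_add monoid)"
proof (rule groupI)
  fix x :: 'a
  show "\<exists>y\<in>carrier additive_group. y \<otimes>\<^bsub>additive_group\<^esub> x = \<one>\<^bsub>additive_group\<^esub>"
    by (rule bexI[where x = "- x"]) (simp_all add: additive_group_def)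
qed (simp_all add: additive_group_def add.assoc)

(* Compactness of C in the ambient group agrees with compactness in the subspace G,
   since C is contained in G. *)
definition compactly_generated :: "'a::topological_group_add set \<Rightarrow> bool" where
  "compactly_generated G \<longleftrightarrow>
     (\<exists>C. C \<subseteq> G \<and> compact C \<and> generate additive_group C = G)"

end

(* Approximate every element of G, up to a sequence of errors tending to 0, by the group generated
   by finitely many elements of G at each scale: a linear basis B of span G chosen in G handles the
   scale R, since rounding real coefficients down to integers leaves a bounded error, and total
   boundedness handles the passage from scale R / 2^n to R / 2^(n+1). As G is countable, a single
   element g_n needs to be corrected at scale R / 2^n, and adding its error (which lies in G) to the
   generators yields a null sequence of finite sets that generates G. *)

theory Submission
  imports Defs
begin

lemma inv_additive_group: "inv\<^bsub>additive_group\<^esub> x = - x"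
  by (rule group.inv_equality[OF group_additive_group]) (simp_all add: additive_group_def)

lemma subgroup_additive_groupD:
  assumes "subgroup H additive_group"
  shows "0 \<in> H"
    and "x \<in> H \<Longrightarrow> y \<in> H \<Longrightarrow> x + y \<in> H"
    and "x \<in> H \<Longrightarrow> - x \<in> H"
    and "x \<in> H \<Longrightarrow> y \<in> H \<Longrightarrow> x - y \<in> H"
proof -
  show "0 \<in> H"
    using subgroup.one_closed[OF assms] by (simp add: additive_group_def)
  show add: "x + y \<in> H" if "x \<in> H" "y \<in> H" for x y
    using subgroup.m_closed[OF assms that] by (simp add: additive_group_def)
  show minus: "- x \<in> H" if "x \<in> H" for x
    using subgroup.m_inv_closed[OF assms that] by (simp add: inv_additive_group)
  show "x - y \<in> H" if "x \<in> H" "y \<in> H"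
    using add[OF that(1) minus[OF that(2)]] by simp
qed

lemma subgroup_additive_group_sum:
  fixes H :: "'a::ab_group_add set"
  assumes "subgroup H additive_group" "\<And>i. i \<in> I \<Longrightarrow> f i \<in> H"
  shows "sum f I \<in> H"
  using assms(2)
  by (induction I rule: infinite_finite_induct) (auto intro: subgroup_additive_groupD[OF assms(1)])

lemma subgroup_additive_group_scaleR_of_int:
  fixes H :: "'a::real_vector set"
  assumes H: "subgroup H additive_group" and x: "x \<in> H"
  shows "of_int k *\<^sub>R x \<in> H"
proof -
  have "of_nat n *\<^sub>R x \<in> H" for n
    by (induction n) (auto simp: scaleR_add_left intro: subgroup_additive_groupD[OF H] x)
  then show ?thesis
    using subgroup_additive_groupD(3)[OF H] by (cases k rule: int_cases2) auto
qed

text \<open>In any open cover, the member containing 0 swallows \<open>K n\<close> for all large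
  \<open>n\<close>, since the radii \<open>e n\<close> tend to 0; the remaining \<open>K n\<close>
  form a finite set, which finitely many members cover.\<close>

lemma compact_insert_zero_UN_finite:
  fixes K :: "nat \<Rightarrow> 'a::real_normed_vector set"
  assumes fin: "\<And>n. finite (K n)" and sub: "\<And>n. K n \<subseteq> cball 0 (e n)"
    and lim: "e \<longlonglongrightarrow> 0"
  shows "compact (insert 0 (\<Union>n. K n))"
proof (rule compactI)
  fix \<U> assume \<U>: "\<forall>U\<in>\<U>. open U" "insert 0 (\<Union>n. K n) \<subseteq> \<Union>\<U>"
  then obtain U where U: "U \<in> \<U>" "0 \<in> U" "open U" by auto
  then obtain d where d: "d > 0" "ball 0 d \<subseteq> U" by (meson openE)
  obtain N where N: "\<And>n. n \<ge> N \<Longrightarrow> e n < d"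
    using order_tendstoD(2)[OF lim d(1)] by (auto simp: eventually_sequentially)
  have tail: "K n \<subseteq> U" if "n \<ge> N" for n
    using sub[of n] N[OF that] d(2) by force
  have "compact (\<Union>n<N. K n)" using fin by (intro finite_imp_compact) auto
  moreover have "(\<Union>n<N. K n) \<subseteq> \<Union>\<U>" using \<U>(2) by blast
  moreover have "\<And>U. U \<in> \<U> \<Longrightarrow> open U" using \<U>(1) by blast
  ultimately obtain \<V> where \<V>: "\<V> \<subseteq> \<U>" "finite \<V>" "(\<Union>n<N. K n) \<subseteq> \<Union>\<V>"
    by (rule compactE)
  have "K n \<subseteq> \<Union>(insert U \<V>)" for n
  proof (cases "n < N")
    case True
    then show ?thesis using \<V>(3) by blast
  next
    case False
    then show ?thesis using tail[of n] by auto
  qed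
  then have "insert 0 (\<Union>n. K n) \<subseteq> \<Union>(insert U \<V>)"
    using U(2) by blast
  then show "\<exists>\<V>\<subseteq>\<U>. finite \<V> \<and> insert 0 (\<Union>n. K n) \<subseteq> \<Union>\<V>"
    using U(1) \<V>(1,2) by (intro exI[of _ "insert U \<V>"]) auto
qed

text \<open>The centres must lie in \<open>S\<close> itself, although \<open>S\<close> need not be
  closed. Balls centred at points of \<open>S\<close> already cover the compact set
  \<open>closure S\<close>, so finitely many of them suffice.\<close>

lemma bounded_imp_finite_net:
  fixes S :: "'a::heine_borel set"
  assumes "bounded S" "e > 0"
  obtains F where "finite F" "F \<subseteq> S" "\<And>x. x \<in> S \<Longrightarrow> \<exists>f\<in>F. dist x f < e"
proof -
  have "closure S \<subseteq> (\<Union>x\<in>S. ball x e)"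
    using assms(2) by (auto simp: closure_approachable)
  moreover have "compact (closure S)" using assms(1) by simp
  ultimately obtain F where "F \<subseteq> S" "finite F" "closure S \<subseteq> (\<Union>x\<in>F. ball x e)"
    using compactE_image[of "closure S" S "\<lambda>x. ball x e"] by (metis open_ball)
  moreover have "\<exists>f\<in>F. dist x f < e" if "x \<in> S" for x
  proof -
    have "x \<in> (\<Union>x\<in>F. ball x e)"
      using calculation that closure_subset by blast
    then show ?thesis by (auto simp: dist_commute)
  qed
  ultimately show thesis using that by blast
qed

lemma compactly_generated_countable_subgroup:
  fixes G :: "'a::euclidean_space set"
  assumes G: "subgroup G additive_group" and cnt: "countable G"
  shows "compactly_generated G"
proof -
  note Gc = subgroup_additive_groupD[OF G]
  obtain B where B: "B \<subseteq> G" "independent B" "G \<subseteq> span B"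
    using basis_exists[of G] by metis
  have finB: "finite B" using B(2) by (rule finiteI_independent)
  \<comment> \<open>The sum bounds the error of rounding coefficients with respect to
    \<open>B\<close>; the summand 1 keeps \<open>R\<close> positive even when \<open>B\<close> is
    empty.\<close>
  define R where "R = 1 + (\<Sum>b\<in>B. norm b)"
  have R: "R > 0" unfolding R_def by (simp add: add_pos_nonneg sum_nonneg)
  define e where "e n = R / 2 ^ n" for n
  have e_pos: "e n > 0" for n using R by (simp add: e_def)
  have e_lim: "e \<longlonglongrightarrow> 0"
    unfolding e_def using LIMSEQ_divide_realpow_zero[of 2 R] by simp
  \<comment> \<open>The net for the ball of radius \<open>e n\<close> has mesh
    \<open>e (Suc n)\<close>, so subtracting one net point from an error of size \<open>e n\<close>
    leaves an error below the next scale.\<close>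
  have "\<exists>F. finite F \<and> F \<subseteq> G \<inter> cball 0 (e n) \<and>
          (\<forall>x\<in>G \<inter> cball 0 (e n). \<exists>f\<in>F. dist x f < e (Suc n))" for n
  proof -
    have "bounded (G \<inter> cball 0 (e n))" by (simp add: bounded_Int)
    from bounded_imp_finite_net[OF this e_pos[of "Suc n"]] show ?thesis by metis
  qed
  then obtain F where F: "\<And>n. finite (F n)" "\<And>n. F n \<subseteq> G \<inter> cball 0 (e n)"
      "\<And>n x. x \<in> G \<inter> cball 0 (e n) \<Longrightarrow> \<exists>f\<in>F n. dist x f < e (Suc n)"
    by metis
  have gen: "subgroup (generate additive_group S) additive_group" for S :: "'a set"
    by (rule group.generate_is_subgroup[OF group_additive_group]) (simp add: additive_group_def)
  \<comment> \<open>By \<open>approx\<close> below, \<open>H\<close> is dense in \<open>G\<close>,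
    but nothing forces equality; the errors \<open>g n - h n\<close> added later close the
    gap.\<close>
  define H where "H = generate additive_group (B \<union> (\<Union>n. F n))"
  have H: "subgroup H additive_group" unfolding H_def by (rule gen)
  have HG: "H \<subseteq> G" unfolding H_def
    using B(1) F(2) by (intro group.generate_subgroup_incl[OF group_additive_group _ G]) blast
  have BH: "b \<in> H" if "b \<in> B" for b
    using that unfolding H_def by (auto intro: generate.incl)
  have FH: "f \<in> H" if "f \<in> F n" for f n
    using that unfolding H_def by (auto intro: generate.incl)
  have approx: "\<exists>h\<in>H. norm (g - h) \<le> e n" if g: "g \<in> G" for g n
  proof (induction n)
    case 0
    from g B(3) obtain u where u: "g = (\<Sum>b\<in>B. u b *\<^sub>R b)"
      by (auto simp: span_finite[OF finB])
    \<comment> \<open>Integer combinations of \<open>B\<close> stay in \<open>H\<close>, and the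
      coefficients of \<open>g - h\<close> are fractional parts in [0, 1).\<close>
    define h where "h = (\<Sum>b\<in>B. of_int \<lfloor>u b\<rfloor> *\<^sub>R b)"
    have "h \<in> H" unfolding h_def
      by (intro subgroup_additive_group_sum subgroup_additive_group_scaleR_of_int H BH)
    moreover have "norm (g - h) \<le> e 0"
    proof -
      have "g - h = (\<Sum>b\<in>B. frac (u b) *\<^sub>R b)"
        by (simp add: u h_def frac_def scaleR_diff_left sum_subtractf)
      also have "norm \<dots> \<le> (\<Sum>b\<in>B. norm b)"
        by (intro sum_norm_le)
          (auto simp: frac_lt_1 less_imp_le intro!: mult_left_le_one_le)
      finally show ?thesis by (simp add: e_def R_def)
    qed
    ultimately show ?case by blast
  next
    case (Suc n)
    then obtain h where h: "h \<in> H" "norm (g - h) \<le> e n" by blast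
    \<comment> \<open>The nets only serve points of \<open>G\<close>, so
      \<open>H \<subseteq> G\<close> is essential here.\<close>
    then have "g - h \<in> G \<inter> cball 0 (e n)" using g HG Gc(4) by auto
    then obtain f where f: "f \<in> F n" "dist (g - h) f < e (Suc n)" using F(3) by blast
    then have "norm (g - (h + f)) \<le> e (Suc n)" by (simp add: dist_norm diff_diff_eq)
    then show ?case using subgroup_additive_groupD(2)[OF H h(1) FH[OF f(1)]] by blast
  qed
  \<comment> \<open>This enumeration of \<open>G\<close> repeats elements if \<open>G\<close> is
    finite.\<close>
  define g where "g = from_nat_into G"
  have gG: "g n \<in> G" for n
    unfolding g_def using Gc(1) by (intro from_nat_into) auto
  have "\<forall>n. \<exists>h. h \<in> H \<and> norm (g n - h) \<le> e n"
    using approx[OF gG] by blast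
  from choice[OF this] obtain h
    where h: "\<And>n. h n \<in> H" "\<And>n. norm (g n - h n) \<le> e n"
    by blast
  have gh: "g n - h n \<in> G" for n
    using gG h(1) HG by (blast intro: Gc(4))
  \<comment> \<open>Only the single error of \<open>g n\<close> enters at scale \<open>e n\<close>,
    so \<open>K n\<close> is finite and lies in the ball of radius \<open>e n\<close>.\<close>
  define K where "K n = insert (g n - h n) (F n)" for n
  \<comment> \<open>The finite set \<open>B\<close> is kept apart, since its elements obey no such
    norm bound; 0 is included as the limit of the shrinking sets \<open>K n\<close>.\<close>
  define C where "C = B \<union> insert 0 (\<Union>n. K n)"
  have "compact (insert 0 (\<Union>n. K n))"
    using F(1,2) h(2) by (intro compact_insert_zero_UN_finite[OF _ _ e_lim]) (auto simp: K_def)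
  then have "compact C"
    unfolding C_def by (rule compact_Un[OF finite_imp_compact[OF finB]])
  moreover have CG: "C \<subseteq> G"
    using B(1) F(2) Gc(1) gh by (auto simp: C_def K_def)
  moreover have "generate additive_group C = G"
  proof
    show "generate additive_group C \<subseteq> G"
      by (rule group.generate_subgroup_incl[OF group_additive_group CG G])
    have HC: "H \<subseteq> generate additive_group C" unfolding H_def
      by (rule group.mono_generate[OF group_additive_group]) (auto simp: C_def K_def)
    have "g n \<in> generate additive_group C" for n
    proof -
      have "g n - h n \<in> generate additive_group C"
        by (rule generate.incl) (auto simp: C_def K_def)
      \<comment> \<open>Here \<open>g n\<close> is recovered as
        \<open>(g n - h n) + h n\<close>.\<close>
      from subgroup_additive_groupD(2)[OF gen this subsetD[OF HC h(1)[of n]]] show ?thesis by simp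
    qed
    moreover have "range g = G"
      unfolding g_def using Gc(1) cnt by (intro range_from_nat_into) auto
    ultimately show "G \<subseteq> generate additive_group C" by blast
  qed
  ultimately show ?thesis unfolding compactly_generated_def by blast
qed

theorem theorem2:
  fixes G :: "(real ^ 'm::finite) set"
  assumes "subgroup G additive_group"
    and "countable G"
  shows "compactly_generated G"
  using assms by (rule compactly_generated_countable_subgroup)

end
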